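(* Let $(G,\tau)$ be a $T_0$ paratopological group, let $(\breve G,\rho)$ be the Raikov completion of the Hausdorff topological group $(G,\tau^\sharp)$ (so that $G$ is a dense subgroup of $(\breve G,\rho)$ and $\rho{\restriction}G=\tau^\sharp$), and let $(\breve G,\breve\tau)$ be the Raikov completion of the paratopological group $(G,\tau)$. Then: (1) $\tau_{sr}\subseteq\tau=\breve\tau{\restriction}G$; (2) $\breve\tau\subseteq\rho=(\breve\tau)^\sharp$; (3) the topology $\breve\tau$ satisfies the separation axiom $T_0$; (4) if the space $(G,\tau)$ is regular, then $\tau=\breve\tau{\restriction}G=\breve\tau_{sr}{\restriction}G$, $\rho=(\breve\tau)^\sharp=(\breve\tau_{sr})^\sharp$, and the topologies $\breve\tau_{sr}\subseteq\breve\tau$ are Hausdorff; (5) if $(G,\tau)$ is a topological group, then $\breve\tau=\rho$.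
   Context: A paratopological group is a group with a topology such that the multiplication is continuous. A space is regular if any neighborhood of any point contains a closed neighborhood of the point (no $T_0$ assumed). For a topology $\sigma$ on $X$ and $A\subseteq X$, $\sigma{\restriction}A$ is the subspace topology. For a topology $\sigma$ on a set $X$, its semiregularization $\sigma_{sr}$ is the topology on $X$ generated by the base of all regular open sets of $(X,\sigma)$, i.e. sets $U$ equal to the interior of their closure; $\breve\tau_{sr}$ means $(\breve\tau)_{sr}$. For a semigroup topology $\sigma$ on a group $\Gamma$ (i.e. one making multiplication continuous), $\sigma^\sharp$ denotes the group topology on $\Gamma$ whose neighborhood base at the identity $e$ consists of the sets $U\cap U^{-1}$ with $e\in U\in\sigma$. If $(G,\tau)$ is a $T_0$ paratopological group, then $(G,\tau^\sharp)$ is a Hausdorff topological group. The Raikov completion of a Hausdorff topological group is the (unique up to topological isomorphism) Hausdorff topological group that contains it as a dense topological subgroup and is complete in its two-sided uniformity. The Raikov completion of the $T_0$ paratopological group $(G,\tau)$ is $(\breve G,\breve\tau)$, where $\breve G$ is the underlying group of the Raikov completion $(\breve G,\rho)$ of $(G,\tau^\sharp)$, and $\breve\tau$ consists of all sets $U\subseteq\breve G$ such that for every $x\in U$ there is $V\in\tau$ with $e\in V$ and $x\overline{V}^{\rho}\subseteq U$, where $\overline{V}^{\rho}$ is the closure of $V$ in $(\breve G,\rho)$; this is a semigroup topology on $\breve G$. *)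

theory Defs
  imports "HOL-Analysis.Analysis" "HOL-Algebra.Coset"
begin

section \<open>Paratopological and topological groups\<close>

definition paratopological_group :: "('a, 'b) monoid_scheme \<Rightarrow> 'a topology \<Rightarrow> bool" where
  "paratopological_group G \<tau> \<longleftrightarrow>
     group G \<and> topspace \<tau> = carrier G \<and>
     continuous_map (prod_topology \<tau> \<tau>) \<tau> (\<lambda>(x, y). x \<otimes>\<^bsub>G\<^esub> y)"

definition topological_group :: "('a, 'b) monoid_scheme \<Rightarrow> 'a topology \<Rightarrow> bool" where
  "topological_group G \<tau> \<longleftrightarrow>
     paratopological_group G \<tau> \<and> continuous_map \<tau> \<tau> (\<lambda>x. inv\<^bsub>G\<^esub> x)"

section \<open>Semiregularization\<close>

definition regular_openin :: "'a topology \<Rightarrow> 'a set \<Rightarrow> bool" where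
  "regular_openin X U \<longleftrightarrow> X interior_of (X closure_of U) = U"

text \<open>The intersection of two regular open sets is regular open and the whole space is
  regular open, so the generating family below is a base of the generated topology.\<close>

definition semiregularization :: "'a topology \<Rightarrow> 'a topology" where
  "semiregularization X = topology_generated_by {U. regular_openin X U}"

section \<open>The group topology associated with a semigroup topology\<close>

text \<open>A group topology is determined by a neighbourhood base at the identity: a set is open
  iff it contains, with each of its points \<open>x\<close>, a translate \<open>x N\<close> of a basic neighbourhood \<open>N\<close>.\<close>

definition sharp :: "('a, 'b) monoid_scheme \<Rightarrow> 'a topology \<Rightarrow> 'a topology" where
  "sharp G \<sigma> = topology (\<lambda>W. W \<subseteq> carrier G \<and>
     (\<forall>x\<in>W. \<exists>U. openin \<sigma> U \<and> \<one>\<^bsub>G\<^esub> \<in> U \<and> x <#\<^bsub>G\<^esub> (U \<inter> set_inv\<^bsub>G\<^esub> U) \<subseteq> W))"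

lemma openin_sharp:
  "openin (sharp G \<sigma>) W \<longleftrightarrow> W \<subseteq> carrier G \<and>
     (\<forall>x\<in>W. \<exists>U. openin \<sigma> U \<and> \<one>\<^bsub>G\<^esub> \<in> U \<and> x <#\<^bsub>G\<^esub> (U \<inter> set_inv\<^bsub>G\<^esub> U) \<subseteq> W)"
proof -
  let ?P = "\<lambda>W. W \<subseteq> carrier G \<and>
     (\<forall>x\<in>W. \<exists>U. openin \<sigma> U \<and> \<one>\<^bsub>G\<^esub> \<in> U \<and> x <#\<^bsub>G\<^esub> (U \<inter> set_inv\<^bsub>G\<^esub> U) \<subseteq> W)"
  have "istopology ?P"
    unfolding istopology_def
  proof (intro conjI allI impI)
    fix S T assume S: "?P S" and T: "?P T"
    show "S \<inter> T \<subseteq> carrier G" using S by blast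
    show "\<forall>x\<in>S \<inter> T. \<exists>U. openin \<sigma> U \<and> \<one>\<^bsub>G\<^esub> \<in> U \<and>
            x <#\<^bsub>G\<^esub> (U \<inter> set_inv\<^bsub>G\<^esub> U) \<subseteq> S \<inter> T"
    proof
      fix x assume x: "x \<in> S \<inter> T"
      obtain U where U: "openin \<sigma> U" "\<one>\<^bsub>G\<^esub> \<in> U" "x <#\<^bsub>G\<^esub> (U \<inter> set_inv\<^bsub>G\<^esub> U) \<subseteq> S"
        using S x by blast
      obtain V where V: "openin \<sigma> V" "\<one>\<^bsub>G\<^esub> \<in> V" "x <#\<^bsub>G\<^esub> (V \<inter> set_inv\<^bsub>G\<^esub> V) \<subseteq> T"
        using T x by blast
      have "x <#\<^bsub>G\<^esub> (U \<inter> V \<inter> set_inv\<^bsub>G\<^esub> (U \<inter> V)) \<subseteq> S \<inter> T"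
        using U(3) V(3) unfolding l_coset_def SET_INV_def by blast
      then show "\<exists>U. openin \<sigma> U \<and> \<one>\<^bsub>G\<^esub> \<in> U \<and> x <#\<^bsub>G\<^esub> (U \<inter> set_inv\<^bsub>G\<^esub> U) \<subseteq> S \<inter> T"
        using U V by blast
    qed
  next
    fix K assume K: "\<forall>S\<in>K. ?P S"
    show "\<Union>K \<subseteq> carrier G" using K by blast
    show "\<forall>x\<in>\<Union>K. \<exists>U. openin \<sigma> U \<and> \<one>\<^bsub>G\<^esub> \<in> U \<and>
            x <#\<^bsub>G\<^esub> (U \<inter> set_inv\<^bsub>G\<^esub> U) \<subseteq> \<Union>K"
      using K by (meson Sup_upper UnionE order_trans)
  qed
  then show ?thesis by (simp add: sharp_def topology_inverse')
qed

section \<open>Raikov completion of a Hausdorff topological group\<close>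

definition two_sided_uniformity ::
    "('a, 'b) monoid_scheme \<Rightarrow> 'a topology \<Rightarrow> ('a \<times> 'a) filter" where
  "two_sided_uniformity G \<tau> =
     (INF U\<in>{U. openin \<tau> U \<and> \<one>\<^bsub>G\<^esub> \<in> U}.
        principal {(x, y). x \<in> carrier G \<and> y \<in> carrier G \<and>
                           inv\<^bsub>G\<^esub> x \<otimes>\<^bsub>G\<^esub> y \<in> U \<and> x \<otimes>\<^bsub>G\<^esub> inv\<^bsub>G\<^esub> y \<in> U})"

text \<open>Completeness is phrased with Cauchy filters, following \<open>cauchy_filter\<close> and
  \<open>complete_uniform\<close> of the type class \<open>uniform_space\<close>.\<close>

definition raikov_complete :: "('a, 'b) monoid_scheme \<Rightarrow> 'a topology \<Rightarrow> bool" where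
  "raikov_complete G \<tau> \<longleftrightarrow>
     (\<forall>F \<le> principal (carrier G). F \<noteq> bot \<longrightarrow> F \<times>\<^sub>F F \<le> two_sided_uniformity G \<tau> \<longrightarrow>
        (\<exists>x\<in>carrier G. F \<le> nhdsin \<tau> x))"

text \<open>\<open>(H, \<rho>)\<close> is a Raikov completion of \<open>(G, \<sigma>)\<close>, the embedding being an inclusion of carriers;
  the two records are only required to have the same multiplication on the smaller carrier.\<close>

definition is_raikov_completion ::
    "('a, 'b) monoid_scheme \<Rightarrow> 'a topology \<Rightarrow> ('a, 'c) monoid_scheme \<Rightarrow> 'a topology \<Rightarrow> bool" where
  "is_raikov_completion G \<sigma> H \<rho> \<longleftrightarrow>
     topological_group H \<rho> \<and> Hausdorff_space \<rho> \<and> raikov_complete H \<rho> \<and>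
     subgroup (carrier G) H \<and>
     (\<forall>x\<in>carrier G. \<forall>y\<in>carrier G. x \<otimes>\<^bsub>G\<^esub> y = x \<otimes>\<^bsub>H\<^esub> y) \<and>
     \<rho> closure_of carrier G = carrier H \<and>
     subtopology \<rho> (carrier G) = \<sigma>"

section \<open>Raikov completion of a paratopological group\<close>

text \<open>Here \<open>(H, \<rho>)\<close> is meant to be the Raikov completion of \<open>(G, sharp G \<tau>)\<close>, where \<open>G\<close> is the
  subgroup of \<open>H\<close> with carrier \<open>topspace \<tau>\<close>; in particular the identity of \<open>G\<close> is that of \<open>H\<close>.\<close>

definition raikov_topology ::
    "('a, 'b) monoid_scheme \<Rightarrow> 'a topology \<Rightarrow> 'a topology \<Rightarrow> 'a topology" where
  "raikov_topology H \<rho> \<tau> = topology (\<lambda>U. U \<subseteq> carrier H \<and>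
     (\<forall>x\<in>U. \<exists>V. openin \<tau> V \<and> \<one>\<^bsub>H\<^esub> \<in> V \<and> x <#\<^bsub>H\<^esub> (\<rho> closure_of V) \<subseteq> U))"

lemma openin_raikov_topology:
  "openin (raikov_topology H \<rho> \<tau>) U \<longleftrightarrow> U \<subseteq> carrier H \<and>
     (\<forall>x\<in>U. \<exists>V. openin \<tau> V \<and> \<one>\<^bsub>H\<^esub> \<in> V \<and> x <#\<^bsub>H\<^esub> (\<rho> closure_of V) \<subseteq> U)"
proof -
  let ?P = "\<lambda>U. U \<subseteq> carrier H \<and>
     (\<forall>x\<in>U. \<exists>V. openin \<tau> V \<and> \<one>\<^bsub>H\<^esub> \<in> V \<and> x <#\<^bsub>H\<^esub> (\<rho> closure_of V) \<subseteq> U)"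
  have "istopology ?P"
    unfolding istopology_def
  proof (intro conjI allI impI)
    fix S T assume S: "?P S" and T: "?P T"
    show "S \<inter> T \<subseteq> carrier H" using S by blast
    show "\<forall>x\<in>S \<inter> T. \<exists>V. openin \<tau> V \<and> \<one>\<^bsub>H\<^esub> \<in> V \<and> x <#\<^bsub>H\<^esub> (\<rho> closure_of V) \<subseteq> S \<inter> T"
    proof
      fix x assume x: "x \<in> S \<inter> T"
      obtain V where V: "openin \<tau> V" "\<one>\<^bsub>H\<^esub> \<in> V" "x <#\<^bsub>H\<^esub> (\<rho> closure_of V) \<subseteq> S"
        using S x by blast
      obtain W where W: "openin \<tau> W" "\<one>\<^bsub>H\<^esub> \<in> W" "x <#\<^bsub>H\<^esub> (\<rho> closure_of W) \<subseteq> T"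
        using T x by blast
      have "\<rho> closure_of (V \<inter> W) \<subseteq> \<rho> closure_of V \<inter> \<rho> closure_of W"
        by (simp add: closure_of_mono)
      then have "x <#\<^bsub>H\<^esub> (\<rho> closure_of (V \<inter> W)) \<subseteq> S \<inter> T"
        using V(3) W(3) unfolding l_coset_def by blast
      then show "\<exists>V. openin \<tau> V \<and> \<one>\<^bsub>H\<^esub> \<in> V \<and> x <#\<^bsub>H\<^esub> (\<rho> closure_of V) \<subseteq> S \<inter> T"
        using V W by blast
    qed
  next
    fix K assume K: "\<forall>S\<in>K. ?P S"
    show "\<Union>K \<subseteq> carrier H" using K by blast
    show "\<forall>x\<in>\<Union>K. \<exists>V. openin \<tau> V \<and> \<one>\<^bsub>H\<^esub> \<in> V \<and> x <#\<^bsub>H\<^esub> (\<rho> closure_of V) \<subseteq> \<Union>K"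
      using K by (meson Sup_upper UnionE order_trans)
  qed
  then show ?thesis by (simp add: raikov_topology_def topology_inverse')
qed

section \<open>Comparison of topologies\<close>

definition coarser_topology :: "'a topology \<Rightarrow> 'a topology \<Rightarrow> bool" where
  "coarser_topology \<sigma> \<tau> \<longleftrightarrow> {U. openin \<sigma> U} \<subseteq> {U. openin \<tau> U}"

end

(*
  Write cl for the closure in (H, rho). The sets x cl V, with V a neighbourhood of the identity in
  (G, tau), are neighbourhoods of x for the completed topology beta. Density of G and continuity of
  conjugation by elements of G make conjugation by any x in H continuous at the identity, so beta
  is a semigroup topology. The inclusion cl V \<inter> G \<subseteq> V V gives tau = beta restricted to G, and a
  similar estimate for cl V and its inverse gives sharp beta = rho, whence T0. If tau is regular,
  then the beta-closure of a small V lies in cl V0 (translate a point of it into G by a small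
  element and use that beta restricts to tau); hence beta itself is regular, equals its
  semiregularization, and being T0 it is Hausdorff.
*)
theory Submission
  imports Defs
begin

text \<open>Inside a locale with a structure, this notation of \<open>HOL-Algebra\<close> makes the topological
  \<open>closure_of\<close> ambiguous.\<close>

no_notation eq_closure_of (\<open>closure'_of\<index>\<close>)

section \<open>Paratopological groups\<close>

lemma l_coset_subset_iff: "x <#\<^bsub>G\<^esub> S \<subseteq> U \<longleftrightarrow> (\<forall>s\<in>S. x \<otimes>\<^bsub>G\<^esub> s \<in> U)"
  by (auto simp: l_coset_def)

lemma (in group) inv_mult_cancel_left:
  assumes "x \<in> carrier G" "y \<in> carrier G"
  shows "inv x \<otimes> (x \<otimes> y) = y" "x \<otimes> (inv x \<otimes> y) = y"
  using assms by (simp_all add: m_assoc[symmetric])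

lemma (in group) mem_set_inv_iff:
  assumes "U \<subseteq> carrier G"
  shows "x \<in> set_inv U \<longleftrightarrow> x \<in> carrier G \<and> inv x \<in> U"
proof
  show "x \<in> set_inv U \<Longrightarrow> x \<in> carrier G \<and> inv x \<in> U"
    using assms by (auto simp: SET_INV_def)
  assume "x \<in> carrier G \<and> inv x \<in> U"
  then show "x \<in> set_inv U"
    by (auto simp: SET_INV_def intro!: bexI[of _ "inv x"])
qed

locale paratop_group =
  fixes G (structure) and \<tau>
  assumes paratop: "paratopological_group G \<tau>"

sublocale paratop_group \<subseteq> group G
  using paratop by (simp add: paratopological_group_def)

context paratop_group
begin

section \<open>Translations, roots and closures\<close>

lemma topspace_eq: "topspace \<tau> = carrier G"
  and continuous_mult: "continuous_map (prod_topology \<tau> \<tau>) \<tau> (\<lambda>(x, y). x \<otimes> y)"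
  using paratop by (auto simp: paratopological_group_def)

lemma openin_carrier: "openin \<tau> (carrier G)"
  by (metis openin_topspace topspace_eq)

lemma openin_subset_carrier: "openin \<tau> U \<Longrightarrow> U \<subseteq> carrier G"
  by (metis openin_subset topspace_eq)

lemma continuous_left_mult:
  assumes "x \<in> carrier G" shows "continuous_map \<tau> \<tau> (\<lambda>y. x \<otimes> y)"
proof -
  have "continuous_map \<tau> (prod_topology \<tau> \<tau>) (\<lambda>y. (x, y))"
    using assms by (auto simp: continuous_map_pairwise o_def topspace_eq)
  from continuous_map_compose[OF this continuous_mult] show ?thesis
    by (simp add: o_def)
qed

lemma continuous_right_mult:
  assumes "x \<in> carrier G" shows "continuous_map \<tau> \<tau> (\<lambda>y. y \<otimes> x)"
proof -
  have "continuous_map \<tau> (prod_topology \<tau> \<tau>) (\<lambda>y. (y, x))"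
    using assms by (auto simp: continuous_map_pairwise o_def topspace_eq)
  from continuous_map_compose[OF this continuous_mult] show ?thesis
    by (simp add: o_def)
qed

lemma openin_left_vimage:
  "openin \<tau> U \<Longrightarrow> x \<in> carrier G \<Longrightarrow> openin \<tau> {y \<in> carrier G. x \<otimes> y \<in> U}"
  using openin_continuous_map_preimage[OF continuous_left_mult] topspace_eq by simp

lemma openin_right_vimage:
  "openin \<tau> U \<Longrightarrow> x \<in> carrier G \<Longrightarrow> openin \<tau> {y \<in> carrier G. y \<otimes> x \<in> U}"
  using openin_continuous_map_preimage[OF continuous_right_mult] topspace_eq by simp

lemma openin_l_coset:
  assumes "openin \<tau> U" "x \<in> carrier G" shows "openin \<tau> (x <# U)"
proof -
  have "x <# U = {y \<in> carrier G. inv x \<otimes> y \<in> U}"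
  proof (intro equalityI subsetI)
    fix y assume "y \<in> x <# U"
    then show "y \<in> {y \<in> carrier G. inv x \<otimes> y \<in> U}"
      using assms openin_subset_carrier[of U] by (auto simp: l_coset_def m_assoc[symmetric])
  next
    fix y assume y: "y \<in> {y \<in> carrier G. inv x \<otimes> y \<in> U}"
    then have "y = x \<otimes> (inv x \<otimes> y)"
      using assms by (simp add: m_assoc[symmetric])
    then show "y \<in> x <# U" using y by (auto simp: l_coset_def)
  qed
  then show ?thesis using openin_left_vimage assms by simp
qed

text \<open>Continuity of multiplication at the identity pair gives a product neighbourhood;
  intersecting its two factors gives one set that serves both arguments.\<close>

lemma open_root:
  assumes "openin \<tau> U" "\<one> \<in> U"
  obtains V where "openin \<tau> V" "\<one> \<in> V" "\<And>a b. a \<in> V \<Longrightarrow> b \<in> V \<Longrightarrow> a \<otimes> b \<in> U"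
proof -
  have "openin (prod_topology \<tau> \<tau>) {p \<in> topspace (prod_topology \<tau> \<tau>). (\<lambda>(x, y). x \<otimes> y) p \<in> U}"
    using openin_continuous_map_preimage[OF continuous_mult assms(1)] .
  moreover have "(\<one>, \<one>) \<in> {p \<in> topspace (prod_topology \<tau> \<tau>). (\<lambda>(x, y). x \<otimes> y) p \<in> U}"
    using assms by (simp add: topspace_eq)
  ultimately obtain A B where AB: "openin \<tau> A" "openin \<tau> B" "\<one> \<in> A" "\<one> \<in> B"
    "A \<times> B \<subseteq> {p \<in> topspace (prod_topology \<tau> \<tau>). (\<lambda>(x, y). x \<otimes> y) p \<in> U}"
    unfolding openin_prod_topology_alt by meson
  show thesis
  proof
    show "openin \<tau> (A \<inter> B)" "\<one> \<in> A \<inter> B" using AB by auto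
    show "a \<otimes> b \<in> U" if "a \<in> A \<inter> B" "b \<in> A \<inter> B" for a b
      using AB(5) that by auto
  qed
qed

lemma open_root_subset:
  assumes "openin \<tau> U" "\<one> \<in> U"
  obtains V where "openin \<tau> V" "\<one> \<in> V" "V \<subseteq> U" "\<And>a b. a \<in> V \<Longrightarrow> b \<in> V \<Longrightarrow> a \<otimes> b \<in> U"
proof -
  obtain V where V: "openin \<tau> V" "\<one> \<in> V" "\<And>a b. a \<in> V \<Longrightarrow> b \<in> V \<Longrightarrow> a \<otimes> b \<in> U"
    using open_root assms by metis
  moreover have "V \<subseteq> U"
  proof
    fix a assume "a \<in> V"
    then show "a \<in> U" using V(2) V(3)[of a \<one>] openin_subset_carrier[OF V(1)] by auto
  qed
  ultimately show thesis using that by blast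
qed

text \<open>The closure of \<open>A \<times> B\<close> is the product of the closures, and the
  continuous multiplication sends it into the closure of the image.\<close>

lemma closure_of_mult:
  assumes "a \<in> \<tau> closure_of A" "b \<in> \<tau> closure_of B"
    and "\<And>x y. x \<in> A \<Longrightarrow> y \<in> B \<Longrightarrow> x \<otimes> y \<in> C"
  shows "a \<otimes> b \<in> \<tau> closure_of C"
proof -
  have "(a, b) \<in> prod_topology \<tau> \<tau> closure_of (A \<times> B)"
    using assms by (simp add: closure_of_Times)
  then have "a \<otimes> b \<in> \<tau> closure_of ((\<lambda>(x, y). x \<otimes> y) ` (A \<times> B))"
    using continuous_map_image_closure_subset[OF continuous_mult] by fastforce
  moreover have "(\<lambda>(x, y). x \<otimes> y) ` (A \<times> B) \<subseteq> C"
    using assms(3) by auto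
  ultimately show ?thesis using closure_of_mono by blast
qed

text \<open>The translate of \<open>U\<close> by \<open>a\<close> is a neighbourhood of
  \<open>a\<close>, so it meets \<open>A\<close>. In this form a point of a closure is moved into
  the set itself by a small factor.\<close>

lemma closure_of_left_nbhd:
  assumes "a \<in> \<tau> closure_of A" "openin \<tau> U" "\<one> \<in> U"
  obtains u where "u \<in> U" "a \<otimes> u \<in> A"
proof -
  have a: "a \<in> carrier G" using assms(1) by (auto simp: in_closure_of topspace_eq)
  moreover have "a \<in> a <# U" using assms(3) a by (force simp: l_coset_def)
  ultimately obtain y where "y \<in> A" "y \<in> a <# U"
    using assms openin_l_coset[of U a] by (auto simp: in_closure_of)
  then show thesis using that by (auto simp: l_coset_def)
qed

lemma closure_of_right_nbhd:
  assumes "a \<in> \<tau> closure_of A" "openin \<tau> U" "\<one> \<in> U"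
  obtains u where "u \<in> U" "u \<otimes> a \<in> A"
proof -
  have a: "a \<in> carrier G" using assms(1) by (auto simp: in_closure_of topspace_eq)
  \<comment> \<open>The right translate of \<open>U\<close> by \<open>a\<close>, written as a
    preimage so that continuity of right multiplication shows it to be open.\<close>
  let ?T = "{y \<in> carrier G. y \<otimes> inv a \<in> U}"
  have "openin \<tau> ?T" "a \<in> ?T" using a assms openin_right_vimage by auto
  then obtain y where y: "y \<in> A" "y \<in> ?T"
    using assms(1) unfolding in_closure_of by meson
  then have "y \<otimes> inv a \<otimes> a = y" using a by (simp add: m_assoc)
  with y that show thesis by (metis (mono_tags, lifting) mem_Collect_eq)
qed

lemma openin_if_left_nbhds:
  assumes "U \<subseteq> carrier G"
    and "\<And>x. x \<in> U \<Longrightarrow> \<exists>V. openin \<tau> V \<and> \<one> \<in> V \<and> (\<forall>v\<in>V. x \<otimes> v \<in> U)"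
  shows "openin \<tau> U"
proof (subst openin_subopen, intro ballI)
  fix x assume x: "x \<in> U"
  then obtain V where V: "openin \<tau> V" "\<one> \<in> V" "\<forall>v\<in>V. x \<otimes> v \<in> U"
    using assms(2) by blast
  have "openin \<tau> (x <# V)" using V x assms(1) openin_l_coset by blast
  moreover have "x \<in> x <# V" using V(2) x assms(1) by (force simp: l_coset_def)
  moreover have "x <# V \<subseteq> U" using V(3) by (simp add: l_coset_subset_iff)
  ultimately show "\<exists>T. openin \<tau> T \<and> x \<in> T \<and> T \<subseteq> U" by blast
qed

section \<open>The associated group topology\<close>

lemma openin_sharp_Int_set_inv:
  assumes "openin \<tau> U"
  shows "openin (sharp G \<tau>) (U \<inter> set_inv U)"
  unfolding openin_sharp
proof (intro conjI ballI)
  note U = openin_subset_carrier[OF assms]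
  show "U \<inter> set_inv U \<subseteq> carrier G" using U by blast
  fix x assume "x \<in> U \<inter> set_inv U"
  then have x: "x \<in> carrier G" "x \<in> U" "inv x \<in> U"
    using mem_set_inv_iff[OF U] by auto
  \<comment> \<open>For \<open>s\<close> in \<open>V\<close> with inverse in \<open>V\<close>, the
    first preimage puts \<open>x \<otimes> s\<close> in \<open>U\<close>, and the second one puts
    its inverse \<open>inv s \<otimes> inv x\<close> in \<open>U\<close>. Inversion reverses the
    order, hence the right translation.\<close>
  define V where "V = {y \<in> carrier G. x \<otimes> y \<in> U} \<inter> {y \<in> carrier G. y \<otimes> inv x \<in> U}"
  have "openin \<tau> V"
    unfolding V_def using openin_left_vimage openin_right_vimage assms x by auto
  moreover have "\<one> \<in> V" using x by (simp add: V_def)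
  moreover have "x <# (V \<inter> set_inv V) \<subseteq> U \<inter> set_inv U"
    unfolding l_coset_subset_iff
  proof
    fix s assume s: "s \<in> V \<inter> set_inv V"
    have V: "V \<subseteq> carrier G" by (auto simp: V_def)
    have "s \<in> carrier G" "s \<in> V" "inv s \<in> V" using s mem_set_inv_iff[OF V] by auto
    then show "x \<otimes> s \<in> U \<inter> set_inv U"
      using x by (auto simp: mem_set_inv_iff[OF U] inv_mult_group V_def)
  qed
  ultimately show "\<exists>V. openin \<tau> V \<and> \<one> \<in> V \<and> x <# (V \<inter> set_inv V) \<subseteq> U \<inter> set_inv U"
    by blast
qed

lemma topspace_sharp: "topspace (sharp G \<tau>) = carrier G"
proof
  show "topspace (sharp G \<tau>) \<subseteq> carrier G"
    using openin_topspace openin_sharp by metis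
  have "carrier G \<inter> set_inv (carrier G) = carrier G"
    using mem_set_inv_iff[of "carrier G"] by auto
  then show "carrier G \<subseteq> topspace (sharp G \<tau>)"
    using openin_sharp_Int_set_inv[OF openin_carrier] openin_subset by metis
qed

text \<open>When inversion is continuous, the basic sets \<open>U \<inter> set_inv U\<close> are
  themselves \<tau>-open, while every \<tau>-neighbourhood of the identity contains such a
  set.\<close>

lemma sharp_eq_if_topological_group:
  assumes "topological_group G \<tau>"
  shows "sharp G \<tau> = \<tau>"
proof -
  have cont: "continuous_map \<tau> \<tau> (\<lambda>x. inv x)"
    using assms by (simp add: topological_group_def)
  have "openin (sharp G \<tau>) W \<longleftrightarrow> openin \<tau> W" for W
  proof
    assume W: "openin (sharp G \<tau>) W"
    show "openin \<tau> W"
    proof (rule openin_if_left_nbhds)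
      show "W \<subseteq> carrier G" using W by (simp add: openin_sharp)
      fix x assume "x \<in> W"
      then obtain U where U: "openin \<tau> U" "\<one> \<in> U" "x <# (U \<inter> set_inv U) \<subseteq> W"
        using W by (auto simp: openin_sharp)
      have "set_inv U = {y \<in> topspace \<tau>. inv y \<in> U}"
        using mem_set_inv_iff[OF openin_subset_carrier[OF U(1)]] by (auto simp: topspace_eq)
      then have "openin \<tau> (U \<inter> set_inv U)" "\<one> \<in> U \<inter> set_inv U"
        using openin_continuous_map_preimage[OF cont U(1)] U by (auto simp: topspace_eq)
      then show "\<exists>V. openin \<tau> V \<and> \<one> \<in> V \<and> (\<forall>v\<in>V. x \<otimes> v \<in> W)"
        using U(3) by (metis l_coset_subset_iff)
    qed
  next
    assume W: "openin \<tau> W"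
    show "openin (sharp G \<tau>) W"
      unfolding openin_sharp
    proof (intro conjI ballI)
      show "W \<subseteq> carrier G" using W openin_subset_carrier by blast
      fix x assume x: "x \<in> W"
      then have xG: "x \<in> carrier G" using W openin_subset_carrier by blast
      have "x <# ({y \<in> carrier G. x \<otimes> y \<in> W} \<inter> set_inv {y \<in> carrier G. x \<otimes> y \<in> W}) \<subseteq> W"
        by (auto simp: l_coset_subset_iff)
      then show "\<exists>U. openin \<tau> U \<and> \<one> \<in> U \<and> x <# (U \<inter> set_inv U) \<subseteq> W"
        using openin_left_vimage[OF W xG] x xG
        by (intro exI[of _ "{y \<in> carrier G. x \<otimes> y \<in> W}"]) auto
    qed
  qed
  then show ?thesis by (simp add: topology_eq)
qed

text \<open>If \<open>y\<close> lies outside x(U \<inter> U^-1), then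
  \<open>inv x \<otimes> y\<close> or its inverse \<open>inv y \<otimes> x\<close> lies outside
  \<open>U\<close>. In the first case xU contains \<open>x\<close> but not \<open>y\<close>, in the
  second yU contains \<open>y\<close> but not \<open>x\<close>; either set separates the points in
  the sense of T0.\<close>

lemma t0_space_if_sharp:
  assumes "t0_space (sharp G \<tau>)"
  shows "t0_space \<tau>"
  unfolding t0_space_def topspace_eq
proof (intro ballI impI)
  have key: "\<exists>U. openin \<tau> U \<and> (x \<notin> U \<longleftrightarrow> y \<in> U)"
    if xy: "x \<in> carrier G" "y \<in> carrier G" and W: "openin (sharp G \<tau>) W" "x \<in> W" "y \<notin> W" for x y W
  proof -
    obtain U where U: "openin \<tau> U" "\<one> \<in> U" "x <# (U \<inter> set_inv U) \<subseteq> W"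
      using W by (auto simp: openin_sharp)
    have Uc: "U \<subseteq> carrier G" using U(1) openin_subset_carrier by blast
    have "y = x \<otimes> (inv x \<otimes> y)" using xy by (simp add: m_assoc[symmetric])
    then have "inv x \<otimes> y \<notin> U \<inter> set_inv U"
      using U(3) W(3) unfolding l_coset_subset_iff by metis
    then have "inv x \<otimes> y \<notin> U \<or> inv y \<otimes> x \<notin> U"
      using mem_set_inv_iff[OF Uc] xy by (auto simp: inv_mult_group)
    then show ?thesis
    proof
      assume "inv x \<otimes> y \<notin> U"
      then show ?thesis
        using openin_left_vimage[OF U(1), of "inv x"] U(2) xy
        by (intro exI[of _ "{z \<in> carrier G. inv x \<otimes> z \<in> U}"]) auto
    next
      assume "inv y \<otimes> x \<notin> U"
      then show ?thesis
        using openin_left_vimage[OF U(1), of "inv y"] U(2) xy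
        by (intro exI[of _ "{z \<in> carrier G. inv y \<otimes> z \<in> U}"]) auto
    qed
  qed
  fix x y assume xy: "x \<in> carrier G" "y \<in> carrier G" "x \<noteq> y"
  then obtain W where "openin (sharp G \<tau>) W" "x \<notin> W \<longleftrightarrow> y \<in> W"
    using assms unfolding t0_space_def topspace_sharp by blast
  then show "\<exists>U. openin \<tau> U \<and> (x \<notin> U \<longleftrightarrow> y \<in> U)"
    using key[of x y W] key[of y x W] xy by blast
qed

end

section \<open>Semiregularization\<close>

text \<open>Regular open sets are open, and the topology that they generate is the coarsest one
  containing them.\<close>

lemma coarser_topology_semiregularization: "coarser_topology (semiregularization X) X"
proof -
  have "openin X U" if "openin (semiregularization X) U" for U
  proof (rule generate_topology_on_coarsest[of "openin X" "{U. regular_openin X U}"])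
    show "istopology (openin X)" by (simp add: istopology_openin)
    show "openin X V" if "V \<in> {U. regular_openin X U}" for V
      using that openin_interior_of[of X "X closure_of V"] by (simp add: regular_openin_def)
    show "generate_topology_on {U. regular_openin X U} U"
      using that by (simp add: semiregularization_def openin_topology_generated_by_iff)
  qed
  then show ?thesis by (auto simp: coarser_topology_def)
qed

lemma semiregularization_eq_if_regular_space:
  assumes "regular_space X"
  shows "semiregularization X = X"
proof -
  have "openin (semiregularization X) U" if U: "openin X U" for U
  proof (subst openin_subopen, intro ballI)
    fix x assume "x \<in> U"
    then obtain V C where VC: "openin X V" "closedin X C" "x \<in> V" "V \<subseteq> C" "C \<subseteq> U"
      using assms U neighbourhood_base_of_closedin[of X]
      unfolding neighbourhood_base_of by meson
    \<comment> \<open>This set is regular open and squeezed between \<open>V\<close> and the closed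
      set \<open>C\<close>, so it fits into \<open>U\<close>.\<close>
    let ?T = "X interior_of (X closure_of V)"
    have "X interior_of (X closure_of ?T) \<subseteq> ?T"
      by (intro interior_of_mono closure_of_minimal interior_of_subset closedin_closure_of)
    moreover have "?T \<subseteq> X interior_of (X closure_of ?T)"
      by (intro interior_of_maximal closure_of_subset interior_of_subset_topspace openin_interior_of)
    ultimately have "regular_openin X ?T"
      by (simp add: regular_openin_def)
    then have "openin (semiregularization X) ?T"
      unfolding semiregularization_def by (simp add: topology_generated_by_Basis)
    moreover have "V \<subseteq> ?T"
      using VC(1) by (meson closure_of_subset interior_of_maximal openin_subset)
    moreover have "?T \<subseteq> C"
      using VC by (meson closure_of_minimal interior_of_subset order_trans)
    ultimately show "\<exists>T. openin (semiregularization X) T \<and> x \<in> T \<and> T \<subseteq> U"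
      using VC by blast
  qed
  then show ?thesis
    using coarser_topology_semiregularization[of X]
    by (auto simp: coarser_topology_def topology_eq)
qed

section \<open>A paratopological group dense in a topological group\<close>

text \<open>The dense subgroup is encoded as the restriction of \<open>H\<close> to
  \<open>K\<close>, so both groups literally share multiplication and identity, and only their
  inverses have to be compared.\<close>

locale raikov_pair = paratop_group H \<rho> for H (structure) and \<rho> +
  fixes K \<tau>
  assumes continuous_inv: "continuous_map \<rho> \<rho> (\<lambda>x. inv x)"
    and subgroup_K: "subgroup K H"
    and paratop_K: "paratopological_group (H\<lparr>carrier := K\<rparr>) \<tau>"
    and dense_K: "\<rho> closure_of K = carrier H"
    and trace: "subtopology \<rho> K = sharp (H\<lparr>carrier := K\<rparr>) \<tau>"

sublocale raikov_pair \<subseteq> K: paratop_group "H\<lparr>carrier := K\<rparr>" \<tau>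
  rewrites "carrier (H\<lparr>carrier := K\<rparr>) = K"
    and "mult (H\<lparr>carrier := K\<rparr>) = mult H"
    and "one (H\<lparr>carrier := K\<rparr>) = one H"
  by (simp_all add: paratop_group_def paratop_K)

context raikov_pair
begin

abbreviation "\<beta> \<equiv> raikov_topology H \<rho> \<tau>"

section \<open>Closures of \<tau>-neighbourhoods in the large group\<close>

lemma K_subset: "K \<subseteq> carrier H"
  using subgroup_K by (rule subgroup.subset)

lemma K_inv: "x \<in> K \<Longrightarrow> inv\<^bsub>H\<lparr>carrier := K\<rparr>\<^esub> x = inv x"
  using m_inv_consistent[OF subgroup_K] .

lemma openin_inv_vimage: "openin \<rho> U \<Longrightarrow> openin \<rho> {y \<in> carrier H. inv y \<in> U}"
  using openin_continuous_map_preimage[OF continuous_inv] topspace_eq by simp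

lemma closure_subset: "\<rho> closure_of V \<subseteq> carrier H"
  by (metis closure_of_subset_topspace topspace_eq)

lemma subset_closure: "openin \<tau> V \<Longrightarrow> V \<subseteq> \<rho> closure_of V"
  using K.openin_subset_carrier[of V] K_subset closure_of_subset[of V \<rho>]
  by (simp add: topspace_eq subset_trans)

lemma closure_root:
  assumes "openin \<tau> V" "\<one> \<in> V"
  obtains W where "openin \<tau> W" "\<one> \<in> W" "W \<subseteq> V"
    "\<And>a b. a \<in> \<rho> closure_of W \<Longrightarrow> b \<in> \<rho> closure_of W \<Longrightarrow> a \<otimes> b \<in> \<rho> closure_of V"
proof -
  obtain W where "openin \<tau> W" "\<one> \<in> W" "W \<subseteq> V" "\<And>a b. a \<in> W \<Longrightarrow> b \<in> W \<Longrightarrow> a \<otimes> b \<in> V"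
    using K.open_root_subset assms by metis
  then show thesis using that closure_of_mult by meson
qed

lemma dense_right_translate:
  assumes "x \<in> carrier H" "openin \<rho> U" "\<one> \<in> U"
  obtains u where "u \<in> U" "x \<otimes> u \<in> K"
  using closure_of_left_nbhd[of x K U] assms dense_K by blast

text \<open>V \<inter> V^-1 is open in the trace of \<rho>, hence cut out on \<open>K\<close> by a
  \<rho>-open set, which is then made symmetric. By density of \<open>K\<close> the resulting
  \<open>U\<close> lies in the closure of \<open>U \<inter> K\<close>, hence in cl V. So closures of
  \<tau>-neighbourhoods are \<rho>-neighbourhoods of the identity.\<close>

lemma sharp_nbhd:
  assumes "openin \<tau> V" "\<one> \<in> V"
  obtains U where "openin \<rho> U" "\<one> \<in> U" "\<And>y. y \<in> U \<Longrightarrow> inv y \<in> U"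
    "U \<inter> K \<subseteq> V" "U \<subseteq> \<rho> closure_of V"
proof -
  have VK: "V \<subseteq> K" using K.openin_subset_carrier assms by blast
  have "openin (subtopology \<rho> K) (V \<inter> set_inv\<^bsub>H\<lparr>carrier := K\<rparr>\<^esub> V)"
    using K.openin_sharp_Int_set_inv[OF assms(1)] trace by simp
  then obtain T where T: "openin \<rho> T" "V \<inter> set_inv\<^bsub>H\<lparr>carrier := K\<rparr>\<^esub> V = T \<inter> K"
    by (auto simp: openin_subtopology)
  define U where "U = T \<inter> {y \<in> carrier H. inv y \<in> T}"
  have U: "openin \<rho> U" unfolding U_def using T openin_inv_vimage by blast
  have "\<one> \<in> V \<inter> set_inv\<^bsub>H\<lparr>carrier := K\<rparr>\<^esub> V"
    using K.mem_set_inv_iff[OF VK] assms(2) VK K_inv[of \<one>] by auto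
  then have one: "\<one> \<in> U" using T(2) by (auto simp: U_def)
  have UK: "U \<inter> K \<subseteq> V" using T(2) by (auto simp: U_def)
  have "U \<subseteq> \<rho> closure_of V"
    using openin_Int_closure_of_subset[OF U, of K] dense_K openin_subset_carrier[OF U]
      closure_of_mono[OF UK] by fastforce
  moreover have "inv y \<in> U" if "y \<in> U" for y
    using that by (simp add: U_def)
  ultimately show thesis using that U one UK by blast
qed

text \<open>The converse comparison: the trace of \<open>W\<close> on \<open>K\<close> is open in
  the associated group topology, so it contains some V \<inter> V^-1.\<close>

lemma small_open:
  assumes "openin \<rho> W" "\<one> \<in> W"
  obtains V where "openin \<tau> V" "\<one> \<in> V" "\<And>v. v \<in> V \<Longrightarrow> inv v \<in> V \<Longrightarrow> v \<in> W"
proof -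
  have "openin (sharp (H\<lparr>carrier := K\<rparr>) \<tau>) (W \<inter> K)"
    using assms(1) trace by (metis openin_subtopology_Int)
  moreover have "\<one> \<in> W \<inter> K" using assms(2) subgroup.one_closed[OF subgroup_K] by simp
  ultimately obtain V where V: "openin \<tau> V" "\<one> \<in> V"
    "\<forall>v\<in>V \<inter> set_inv\<^bsub>H\<lparr>carrier := K\<rparr>\<^esub> V. \<one> \<otimes> v \<in> W \<inter> K"
    unfolding openin_sharp l_coset_subset_iff by auto
  have VK: "V \<subseteq> K" using K.openin_subset_carrier V by blast
  show thesis
  proof
    fix v assume v: "v \<in> V" "inv v \<in> V"
    then have "v \<in> set_inv\<^bsub>H\<lparr>carrier := K\<rparr>\<^esub> V"
      using K.mem_set_inv_iff[OF VK] VK K_inv[of v] by auto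
    then have "\<one> \<otimes> v \<in> W" using V(3) v by blast
    then show "v \<in> W" using v VK K_subset by auto
  qed (use V in auto)
qed

section \<open>The completed topology is a semigroup topology\<close>

lemma openin_beta:
  "openin \<beta> U \<longleftrightarrow> U \<subseteq> carrier H \<and>
    (\<forall>x\<in>U. \<exists>V. openin \<tau> V \<and> \<one> \<in> V \<and> (\<forall>v\<in>\<rho> closure_of V. x \<otimes> v \<in> U))"
  by (simp add: openin_raikov_topology l_coset_subset_iff)

lemma topspace_beta: "topspace \<beta> = carrier H"
proof
  show "topspace \<beta> \<subseteq> carrier H" by (meson openin_beta openin_topspace)
  have "openin \<beta> (carrier H)"
    unfolding openin_beta using K.openin_carrier K.one_closed closure_subset by blast
  then show "carrier H \<subseteq> topspace \<beta>" by (rule openin_subset)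
qed

text \<open>The translate of cl V by \<open>x\<close> need not be \<beta>-open, but it contains a
  \<beta>-open set around \<open>x\<close>. Later arguments only use this set through its last
  property.\<close>

lemma beta_nbhd:
  assumes x: "x \<in> carrier H" and V: "openin \<tau> V" "\<one> \<in> V"
  obtains U where "openin \<beta> U" "x \<in> U" "\<And>y. y \<in> U \<Longrightarrow> inv x \<otimes> y \<in> \<rho> closure_of V"
proof -
  \<comment> \<open>The candidate for the \<beta>-interior of the translate: all \<open>y\<close>
    for which some y cl W is contained in x cl V. Openness follows by replacing \<open>W\<close>
    with a root \<open>W'\<close>.\<close>
  define U where "U = {y \<in> carrier H. \<exists>W. openin \<tau> W \<and> \<one> \<in> W \<and>
    (\<forall>w\<in>\<rho> closure_of W. inv x \<otimes> y \<otimes> w \<in> \<rho> closure_of V)}"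
  show thesis
  proof
    show "openin \<beta> U"
      unfolding openin_beta
    proof (intro conjI ballI)
      show "U \<subseteq> carrier H" by (auto simp: U_def)
      fix y assume "y \<in> U"
      then obtain W where y: "y \<in> carrier H" and W: "openin \<tau> W" "\<one> \<in> W"
        "\<forall>w\<in>\<rho> closure_of W. inv x \<otimes> y \<otimes> w \<in> \<rho> closure_of V"
        by (auto simp: U_def)
      obtain W' where W': "openin \<tau> W'" "\<one> \<in> W'"
        "\<And>a b. a \<in> \<rho> closure_of W' \<Longrightarrow> b \<in> \<rho> closure_of W' \<Longrightarrow> a \<otimes> b \<in> \<rho> closure_of W"
        using closure_root W by metis
      have "y \<otimes> v \<in> U" if v: "v \<in> \<rho> closure_of W'" for v
      proof -
        have vc: "v \<in> carrier H" using v closure_subset by blast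
        have "inv x \<otimes> (y \<otimes> v) \<otimes> w \<in> \<rho> closure_of V" if w: "w \<in> \<rho> closure_of W'" for w
        proof -
          have "w \<in> carrier H" using w closure_subset by blast
          then have "inv x \<otimes> (y \<otimes> v) \<otimes> w = inv x \<otimes> y \<otimes> (v \<otimes> w)"
            using x y vc by (simp add: m_assoc)
          then show ?thesis using W(3) W'(3)[OF v w] by simp
        qed
        then show ?thesis using W' y vc by (auto simp: U_def)
      qed
      then show "\<exists>V. openin \<tau> V \<and> \<one> \<in> V \<and> (\<forall>v\<in>\<rho> closure_of V. y \<otimes> v \<in> U)"
        using W' by blast
    qed
    have "inv x \<otimes> x \<otimes> w = w" if "w \<in> \<rho> closure_of V" for w
      using that x closure_subset by (simp add: subset_iff)
    then show "x \<in> U" using x V by (auto simp: U_def)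
    fix y assume "y \<in> U"
    \<comment> \<open>The condition defining \<open>U\<close> is used at w = 1, which belongs to
      \<open>W\<close> and so to its closure.\<close>
    then obtain W where "y \<in> carrier H" "openin \<tau> W" "\<one> \<in> W"
      "inv x \<otimes> y \<otimes> \<one> \<in> \<rho> closure_of V"
      unfolding U_def using subset_closure by blast
    then show "inv x \<otimes> y \<in> \<rho> closure_of V" using x by simp
  qed
qed

text \<open>For \<open>x\<close> in \<open>K\<close> this would be continuity of translations in
  \<tau>. In general, density gives g = xy in \<open>K\<close> with \<open>y\<close> and its inverse
  in cl V2. Conjugation by \<open>g\<close> is controlled inside \<open>K\<close>, and the
  difference between \<open>x\<close> and \<open>g\<close> costs only the two small factors in inv x
  w x = y (inv g w g) inv y.\<close>

lemma closure_conj: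
  assumes x: "x \<in> carrier H" and V: "openin \<tau> V" "\<one> \<in> V"
  obtains W where "openin \<tau> W" "\<one> \<in> W"
    "\<And>w. w \<in> \<rho> closure_of W \<Longrightarrow> inv x \<otimes> w \<otimes> x \<in> \<rho> closure_of V"
proof -
  obtain V1 where V1: "openin \<tau> V1" "\<one> \<in> V1"
    "\<And>a b. a \<in> \<rho> closure_of V1 \<Longrightarrow> b \<in> \<rho> closure_of V1 \<Longrightarrow> a \<otimes> b \<in> \<rho> closure_of V"
    using closure_root V by metis
  obtain V2 where V2: "openin \<tau> V2" "\<one> \<in> V2" "V2 \<subseteq> V1"
    "\<And>a b. a \<in> \<rho> closure_of V2 \<Longrightarrow> b \<in> \<rho> closure_of V2 \<Longrightarrow> a \<otimes> b \<in> \<rho> closure_of V1"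
    using closure_root V1(1,2) by metis
  have V21: "\<rho> closure_of V2 \<subseteq> \<rho> closure_of V1" using V2(3) by (rule closure_of_mono)
  obtain U where U: "openin \<rho> U" "\<one> \<in> U" "\<And>y. y \<in> U \<Longrightarrow> inv y \<in> U" "U \<subseteq> \<rho> closure_of V2"
    using sharp_nbhd V2(1,2) by metis
  obtain y where y: "y \<in> U" "x \<otimes> y \<in> K" using dense_right_translate x U by metis
  define g where "g = x \<otimes> y"
  have yc: "y \<in> carrier H" using y U openin_subset_carrier by blast
  have g: "g \<in> K" "g \<in> carrier H" "inv g \<in> K"
    using y K_subset subgroup.m_inv_closed[OF subgroup_K] by (auto simp: g_def)
  \<comment> \<open>The preimage of \<open>V2\<close> under conjugation by \<open>g\<close>, split
    into two translations of \<open>K\<close>. The bound on \<open>W\<close> then passes to its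
    \<rho>-closure, since these translations are also \<rho>-continuous.\<close>
  define W where "W = {w \<in> K. inv g \<otimes> w \<in> {u \<in> K. u \<otimes> g \<in> V2}}"
  have W: "openin \<tau> W"
    unfolding W_def
    using K.openin_left_vimage[OF K.openin_right_vimage[OF V2(1) g(1)] g(3)] .
  have "\<one> \<in> W"
    using g V2(2) by (simp add: W_def subgroup.one_closed[OF subgroup_K])
  moreover have "inv x \<otimes> w \<otimes> x \<in> \<rho> closure_of V" if w: "w \<in> \<rho> closure_of W" for w
  proof -
    have wc: "w \<in> carrier H" using w closure_subset by blast
    have "(inv g \<otimes> w) \<otimes> g \<in> \<rho> closure_of V2"
    proof (rule closure_of_mult[where A = "(\<lambda>w. inv g \<otimes> w) ` W" and B = "{g}"])
      show "inv g \<otimes> w \<in> \<rho> closure_of (\<lambda>w. inv g \<otimes> w) ` W"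
        using continuous_map_image_closure_subset[OF continuous_left_mult[of "inv g"]] w g by blast
      show "g \<in> \<rho> closure_of {g}"
        using closure_of_subset[of "{g}" \<rho>] g topspace_eq by auto
    qed (auto simp: W_def)
    moreover have "y \<in> \<rho> closure_of V2" "inv y \<in> \<rho> closure_of V2" using y U by auto
    \<comment> \<open>Three factors from cl V2: the right pair multiplies into cl V1, and
      multiplying by \<open>y\<close> on the left lands in cl V.\<close>
    ultimately have "y \<otimes> ((inv g \<otimes> w \<otimes> g) \<otimes> inv y) \<in> \<rho> closure_of V"
      using V1(3) V2(4) V21 by blast
    moreover have "y \<otimes> ((inv g \<otimes> w \<otimes> g) \<otimes> inv y) = (y \<otimes> inv g) \<otimes> w \<otimes> (g \<otimes> inv y)"
      using g yc wc by (simp add: m_assoc)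
    moreover have "y \<otimes> inv g = inv x"
      using x yc by (simp add: g_def inv_mult_group m_assoc[symmetric])
    moreover have "g \<otimes> inv y = x" using x yc by (simp add: g_def m_assoc)
    ultimately show ?thesis by simp
  qed
  ultimately show thesis using that W by blast
qed

text \<open>Writing a = xs and b = yt gives ab = xy (inv y s y) t. The conjugate of \<open>s\<close>
  is kept small by \<open>closure_conj\<close>, and a root absorbs the product with
  \<open>t\<close>.\<close>

lemma paratop_beta: "paratopological_group H \<beta>"
  unfolding paratopological_group_def
proof (intro conjI)
  show "group H" by (rule is_group)
  show "topspace \<beta> = carrier H" by (rule topspace_beta)
  show "continuous_map (prod_topology \<beta> \<beta>) \<beta> (\<lambda>(x, y). x \<otimes> y)"
    unfolding continuous_map_def
  proof (intro conjI allI impI)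
    show "(\<lambda>(x, y). x \<otimes> y) \<in> topspace (prod_topology \<beta> \<beta>) \<rightarrow> topspace \<beta>"
      by (auto simp: topspace_beta)
    fix U assume U: "openin \<beta> U"
    show "openin (prod_topology \<beta> \<beta>)
            {p \<in> topspace (prod_topology \<beta> \<beta>). (\<lambda>(x, y). x \<otimes> y) p \<in> U}" (is "openin _ ?P")
      unfolding openin_prod_topology_alt
    proof (intro allI impI)
      fix x y assume "(x, y) \<in> ?P"
      then have x: "x \<in> carrier H" and y: "y \<in> carrier H" and xy: "x \<otimes> y \<in> U"
        by (auto simp: topspace_beta)
      obtain V where V: "openin \<tau> V" "\<one> \<in> V" "\<forall>v\<in>\<rho> closure_of V. x \<otimes> y \<otimes> v \<in> U"
        using U xy by (auto simp: openin_beta)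
      obtain V1 where V1: "openin \<tau> V1" "\<one> \<in> V1"
        "\<And>a b. a \<in> \<rho> closure_of V1 \<Longrightarrow> b \<in> \<rho> closure_of V1 \<Longrightarrow> a \<otimes> b \<in> \<rho> closure_of V"
        using closure_root V(1,2) by metis
      obtain W where W: "openin \<tau> W" "\<one> \<in> W"
        "\<And>w. w \<in> \<rho> closure_of W \<Longrightarrow> inv y \<otimes> w \<otimes> y \<in> \<rho> closure_of V1"
        using closure_conj y V1(1,2) by metis
      obtain A where A: "openin \<beta> A" "x \<in> A" "\<And>a. a \<in> A \<Longrightarrow> inv x \<otimes> a \<in> \<rho> closure_of W"
        using beta_nbhd x W(1,2) by metis
      obtain B where B: "openin \<beta> B" "y \<in> B" "\<And>b. b \<in> B \<Longrightarrow> inv y \<otimes> b \<in> \<rho> closure_of V1"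
        using beta_nbhd y V1(1,2) by metis
      have "A \<times> B \<subseteq> ?P"
      proof
        fix p assume "p \<in> A \<times> B"
        then obtain a b where p: "p = (a, b)" "a \<in> A" "b \<in> B" by blast
        then have ab: "a \<in> carrier H" "b \<in> carrier H"
          using A B openin_subset topspace_beta by blast+
        have "(inv y \<otimes> (inv x \<otimes> a) \<otimes> y) \<otimes> (inv y \<otimes> b) \<in> \<rho> closure_of V"
          using A(3)[OF p(2)] B(3)[OF p(3)] W(3) V1(3) by blast
        then have "x \<otimes> y \<otimes> ((inv y \<otimes> (inv x \<otimes> a) \<otimes> y) \<otimes> (inv y \<otimes> b)) \<in> U" using V(3) by blast
        moreover have "x \<otimes> y \<otimes> ((inv y \<otimes> (inv x \<otimes> a) \<otimes> y) \<otimes> (inv y \<otimes> b)) = a \<otimes> b"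
          using x y ab by (simp add: m_assoc inv_mult_cancel_left)
        ultimately show "p \<in> ?P" using p ab by (simp add: topspace_beta)
      qed
      then show "\<exists>A B. openin \<beta> A \<and> openin \<beta> B \<and> x \<in> A \<and> y \<in> B \<and> A \<times> B \<subseteq> ?P"
        using A B by blast
    qed
  qed
qed

interpretation B: paratop_group H \<beta>
  using paratop_beta by (simp add: paratop_group_def)

section \<open>Comparison of \<beta> with \<rho> and with \<tau>\<close>

lemma beta_coarser: "openin \<beta> U \<Longrightarrow> openin \<rho> U"
proof (rule openin_if_left_nbhds)
  assume U: "openin \<beta> U"
  show "U \<subseteq> carrier H" using U by (simp add: openin_beta)
  fix x assume "x \<in> U"
  then obtain V where "openin \<tau> V" "\<one> \<in> V" "\<forall>v\<in>\<rho> closure_of V. x \<otimes> v \<in> U"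
    using U by (auto simp: openin_beta)
  then show "\<exists>V. openin \<rho> V \<and> \<one> \<in> V \<and> (\<forall>v\<in>V. x \<otimes> v \<in> U)"
    using sharp_nbhd[of V] by (metis subset_iff)
qed

lemma closure_subset_beta_closure: "\<rho> closure_of V \<subseteq> \<beta> closure_of V"
  using beta_coarser by (auto simp: in_closure_of topspace_eq topspace_beta)

lemma subtopology_beta: "subtopology \<beta> K = \<tau>"
proof -
  have "openin (subtopology \<beta> K) A \<longleftrightarrow> openin \<tau> A" for A
  proof
    assume "openin (subtopology \<beta> K) A"
    then obtain U where U: "openin \<beta> U" "A = U \<inter> K" by (auto simp: openin_subtopology)
    show "openin \<tau> A"
    proof (rule K.openin_if_left_nbhds)
      show "A \<subseteq> K" using U by blast
      fix x assume "x \<in> A"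
      then have x: "x \<in> K" "x \<in> U" using U by auto
      then obtain V where V: "openin \<tau> V" "\<one> \<in> V" "\<forall>v\<in>\<rho> closure_of V. x \<otimes> v \<in> U"
        using U by (auto simp: openin_beta)
      have "x \<otimes> v \<in> A" if v: "v \<in> V" for v
        using v V x U subset_closure[OF V(1)] K.openin_subset_carrier[OF V(1)]
          subgroup.m_closed[OF subgroup_K, of x v] by blast
      then show "\<exists>V. openin \<tau> V \<and> \<one> \<in> V \<and> (\<forall>v\<in>V. x \<otimes> v \<in> A)" using V by blast
    qed
  next
    assume A: "openin \<tau> A"
    note AK = K.openin_subset_carrier[OF A]
    show "openin (subtopology \<beta> K) A"
    proof (subst openin_subopen, intro ballI)
      fix x assume xA: "x \<in> A"
      then have xK: "x \<in> K" and x: "x \<in> carrier H" using AK K_subset by auto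
      have "openin \<tau> {y \<in> K. x \<otimes> y \<in> A}" "\<one> \<in> {y \<in> K. x \<otimes> y \<in> A}"
        using K.openin_left_vimage[OF A xK] xA x subgroup.one_closed[OF subgroup_K] by auto
      then obtain V where V: "openin \<tau> V" "\<one> \<in> V"
        "\<And>a b. a \<in> V \<Longrightarrow> b \<in> V \<Longrightarrow> a \<otimes> b \<in> {y \<in> K. x \<otimes> y \<in> A}"
        by (rule K.open_root) (rule that)
      obtain O' where O': "openin \<rho> O'" "\<one> \<in> O'" "\<And>y. y \<in> O' \<Longrightarrow> inv y \<in> O'" "O' \<inter> K \<subseteq> V"
        using sharp_nbhd V(1,2) by metis
      obtain U where U: "openin \<beta> U" "x \<in> U" "\<And>y. y \<in> U \<Longrightarrow> inv x \<otimes> y \<in> \<rho> closure_of V"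
        using beta_nbhd x V(1,2) by metis
      have "U \<inter> K \<subseteq> A"
      proof
        fix y assume y: "y \<in> U \<inter> K"
        define g where "g = inv x \<otimes> y"
        have g: "g \<in> K" "g \<in> carrier H"
          using y xK subgroup.m_closed[OF subgroup_K] subgroup.m_inv_closed[OF subgroup_K] K_subset
          by (auto simp: g_def)
        \<comment> \<open>This is where cl V \<inter> K is shown to lie in V V. Both
          \<open>g\<close> and \<open>g \<otimes> p\<close> belong to \<open>K\<close>, hence so
          does \<open>p\<close>; as \<open>O'\<close> is symmetric and its trace on \<open>K\<close>
          lies in \<open>V\<close>, the inverse of \<open>p\<close> is in \<open>V\<close>, and g =
          (gp) inv p.\<close>
        obtain p where p: "p \<in> O'" "g \<otimes> p \<in> V"
          using closure_of_left_nbhd[of g V O'] U(3)[of y] y O' by (auto simp: g_def)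
        have pc: "p \<in> carrier H" using p O' openin_subset_carrier by blast
        have "inv g \<otimes> (g \<otimes> p) \<in> K"
          using g p K.openin_subset_carrier[OF V(1)] subgroup.m_closed[OF subgroup_K]
            subgroup.m_inv_closed[OF subgroup_K] by blast
        then have "p \<in> K" using g pc by (simp add: m_assoc[symmetric])
        then have "inv p \<in> V" using p O' subgroup.m_inv_closed[OF subgroup_K] by blast
        then have "x \<otimes> (g \<otimes> p \<otimes> inv p) \<in> A" using V(3) p by blast
        moreover have "x \<otimes> (g \<otimes> p \<otimes> inv p) = y"
          using g pc x y K_subset by (simp add: m_assoc) (simp add: g_def m_assoc[symmetric] subset_iff)
        ultimately show "y \<in> A" by simp
      qed
      then show "\<exists>T. openin (subtopology \<beta> K) T \<and> x \<in> T \<and> T \<subseteq> A"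
        using U xK by (intro exI[of _ "U \<inter> K"]) (auto simp: openin_subtopology)
    qed
  qed
  then show ?thesis by (simp add: topology_eq)
qed

text \<open>One inclusion holds because \<beta> is coarser than \<rho> and \<rho>-inversion is
  continuous. For the other, an element \<open>z\<close> that lies in cl V1 together with its
  inverse is moved into \<open>K\<close> by a small \<open>p\<close> so that both zp and its inverse
  fall into \<open>V\<close>; \<open>small_open\<close> then makes zp, and hence \<open>z\<close>,
  small for \<rho>.\<close>

lemma sharp_beta: "sharp H \<beta> = \<rho>"
proof -
  have "openin (sharp H \<beta>) W \<longleftrightarrow> openin \<rho> W" for W
  proof
    assume W: "openin (sharp H \<beta>) W"
    show "openin \<rho> W"
    proof (rule openin_if_left_nbhds)
      show "W \<subseteq> carrier H" using W by (simp add: openin_sharp)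
      fix x assume "x \<in> W"
      then obtain U where U: "openin \<beta> U" "\<one> \<in> U" "x <# (U \<inter> set_inv U) \<subseteq> W"
        using W by (auto simp: openin_sharp)
      have "U \<inter> set_inv U = U \<inter> {y \<in> carrier H. inv y \<in> U}"
        using mem_set_inv_iff[OF B.openin_subset_carrier[OF U(1)]] by auto
      then have "openin \<rho> (U \<inter> set_inv U)" "\<one> \<in> U \<inter> set_inv U"
        using beta_coarser[OF U(1)] openin_inv_vimage U(2) by auto
      then show "\<exists>V. openin \<rho> V \<and> \<one> \<in> V \<and> (\<forall>v\<in>V. x \<otimes> v \<in> W)"
        using U(3) by (metis l_coset_subset_iff)
    qed
  next
    assume W: "openin \<rho> W"
    show "openin (sharp H \<beta>) W"
      unfolding openin_sharp
    proof (intro conjI ballI)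
      show "W \<subseteq> carrier H" using W openin_subset_carrier by blast
      fix x assume xW: "x \<in> W"
      then have x: "x \<in> carrier H" using W openin_subset_carrier by blast
      have "openin \<rho> {y \<in> carrier H. x \<otimes> y \<in> W}" "\<one> \<in> {y \<in> carrier H. x \<otimes> y \<in> W}"
        using openin_left_vimage[OF W x] xW x by auto
      then obtain T where T: "openin \<rho> T" "\<one> \<in> T"
        "\<And>a b. a \<in> T \<Longrightarrow> b \<in> T \<Longrightarrow> a \<otimes> b \<in> {y \<in> carrier H. x \<otimes> y \<in> W}"
        by (rule open_root) (rule that)
      obtain V where V: "openin \<tau> V" "\<one> \<in> V" "\<And>v. v \<in> V \<Longrightarrow> inv v \<in> V \<Longrightarrow> v \<in> T"
        using small_open T(1,2) by metis
      obtain V1 where V1: "openin \<tau> V1" "\<one> \<in> V1" "V1 \<subseteq> V"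
        "\<And>a b. a \<in> V1 \<Longrightarrow> b \<in> V1 \<Longrightarrow> a \<otimes> b \<in> V"
        using K.open_root_subset V(1,2) by metis
      obtain Q where Q: "openin \<rho> Q" "\<one> \<in> Q" "\<And>y. y \<in> Q \<Longrightarrow> inv y \<in> Q" "Q \<inter> K \<subseteq> V1"
        using sharp_nbhd V1(1,2) by metis
      obtain P0 where P0: "openin \<rho> P0" "\<one> \<in> P0" "\<And>a b. a \<in> P0 \<Longrightarrow> b \<in> P0 \<Longrightarrow> a \<otimes> b \<in> Q"
        using open_root Q(1,2) by metis
      \<comment> \<open>Products of two elements of \<open>P\<close> fall into \<open>Q\<close>, and
        inverses of elements of \<open>P\<close> fall into \<open>T\<close>; the latter serves to
        remove the factor \<open>p\<close> at the end.\<close>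
      define P where "P = P0 \<inter> {y \<in> carrier H. inv y \<in> T}"
      have P: "openin \<rho> P" "\<one> \<in> P"
        using P0 T openin_inv_vimage by (auto simp: P_def)
      obtain U where U: "openin \<beta> U" "\<one> \<in> U" "\<And>y. y \<in> U \<Longrightarrow> inv \<one> \<otimes> y \<in> \<rho> closure_of V1"
        using beta_nbhd[OF one_closed V1(1,2)] by metis
      note Uc = B.openin_subset_carrier[OF U(1)]
      have "x <# (U \<inter> set_inv U) \<subseteq> W"
        unfolding l_coset_subset_iff
      proof
        fix z assume "z \<in> U \<inter> set_inv U"
        then have z: "z \<in> carrier H" "z \<in> U" "inv z \<in> U" using mem_set_inv_iff[OF Uc] by auto
        then have zc: "z \<in> \<rho> closure_of V1" "inv z \<in> \<rho> closure_of V1"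
          using U(3)[of z] U(3)[of "inv z"] by auto
        obtain p where p: "p \<in> P" "z \<otimes> p \<in> V1" using closure_of_left_nbhd zc P by metis
        obtain q where q: "q \<in> P" "q \<otimes> inv z \<in> V1" using closure_of_right_nbhd zc P by metis
        have pq: "p \<in> carrier H" "q \<in> carrier H" using p q by (auto simp: P_def)
        \<comment> \<open>Multiplying the two approximants cancels \<open>z\<close>, which shows
          that \<open>q \<otimes> p\<close> is in \<open>K\<close> although \<open>p\<close> and
          \<open>q\<close> separately need not be. Its inverse is therefore in \<open>V1\<close> and
          turns \<open>q \<otimes> inv z\<close> into the inverse of
          \<open>z \<otimes> p\<close>.\<close>
        have "q \<otimes> inv z \<otimes> (z \<otimes> p) = q \<otimes> p"
          using pq z by (simp add: m_assoc inv_mult_cancel_left)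
        then have "q \<otimes> p \<in> K"
          using p q K.openin_subset_carrier[OF V1(1)] subgroup.m_closed[OF subgroup_K] by (metis subset_iff)
        moreover have "q \<otimes> p \<in> Q" using P0 p q by (auto simp: P_def)
        ultimately have "inv (q \<otimes> p) \<in> V1"
          using Q subgroup.m_inv_closed[OF subgroup_K] by blast
        then have "inv (q \<otimes> p) \<otimes> (q \<otimes> inv z) \<in> V" using V1(4) q by blast
        moreover have "inv (q \<otimes> p) \<otimes> (q \<otimes> inv z) = inv (z \<otimes> p)"
          using pq z by (simp add: inv_mult_group m_assoc inv_mult_cancel_left)
        ultimately have "z \<otimes> p \<in> T" using V(3) V1(3) p by auto
        moreover have "inv p \<in> T" using p by (simp add: P_def)
        ultimately have "x \<otimes> (z \<otimes> p \<otimes> inv p) \<in> W" using T(3) by blast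
        then show "x \<otimes> z \<in> W" using pq z by (simp add: m_assoc)
      qed
      then show "\<exists>U. openin \<beta> U \<and> \<one> \<in> U \<and> x <# (U \<inter> set_inv U) \<subseteq> W"
        using U by blast
    qed
  qed
  then show ?thesis by (simp add: topology_eq)
qed

section \<open>Regularity, the topological group case and T0\<close>

lemma regular_space_beta:
  assumes "regular_space \<tau>"
  shows "regular_space \<beta>"
  unfolding neighbourhood_base_of_closedin[symmetric] neighbourhood_base_of
proof (intro allI impI)
  fix U x assume Ux: "openin \<beta> U \<and> x \<in> U"
  then have x: "x \<in> carrier H" using B.openin_subset_carrier by blast
  obtain V0 where V0: "openin \<tau> V0" "\<one> \<in> V0" "\<forall>v\<in>\<rho> closure_of V0. x \<otimes> v \<in> U"
    using Ux by (auto simp: openin_beta)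
  obtain V' C where V': "openin \<tau> V'" "closedin \<tau> C" "\<one> \<in> V'" "V' \<subseteq> C" "C \<subseteq> V0"
    using assms V0(1,2) unfolding neighbourhood_base_of_closedin[symmetric] neighbourhood_base_of
    by meson
  obtain V where V: "openin \<tau> V" "\<one> \<in> V"
    "\<And>a b. a \<in> V \<Longrightarrow> b \<in> V \<Longrightarrow> a \<otimes> b \<in> V'"
    using K.open_root V' by metis
  obtain O' where O': "openin \<rho> O'" "\<one> \<in> O'" "O' \<subseteq> \<rho> closure_of V"
    using sharp_nbhd V(1,2) by metis
  \<comment> \<open>Every \<rho>-neighbourhood \<open>T\<close> of \<open>z\<close> contains some zy
    in \<open>K\<close> with \<open>y\<close> in \<open>O'\<close>, hence in the \<beta>-closure of
    \<open>V\<close>. Then zy is in the \<beta>-closure of \<open>V'\<close>; on \<open>K\<close>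
    this is the \<tau>-closure, which lies in \<open>C\<close> and so in \<open>V0\<close>. Thus
    \<open>T\<close> meets \<open>V0\<close>.\<close>
  have sub: "\<beta> closure_of V \<subseteq> \<rho> closure_of V0"
  proof
    fix z assume zV: "z \<in> \<beta> closure_of V"
    then have z: "z \<in> carrier H" by (auto simp: in_closure_of topspace_beta)
    show "z \<in> \<rho> closure_of V0"
      unfolding in_closure_of topspace_eq
    proof (intro conjI allI impI z)
      fix T assume T: "z \<in> T \<and> openin \<rho> T"
      obtain y where y: "y \<in> O' \<inter> {y \<in> carrier H. z \<otimes> y \<in> T}" "z \<otimes> y \<in> K"
        using dense_right_translate[OF z, of "O' \<inter> {y \<in> carrier H. z \<otimes> y \<in> T}"]
          O' T z openin_left_vimage[of T z] by auto
      then have "y \<in> \<beta> closure_of V" using O' closure_subset_beta_closure by blast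
      then have "z \<otimes> y \<in> \<beta> closure_of V'"
        using B.closure_of_mult[OF zV] V(3) by blast
      moreover have "\<tau> closure_of V' = K \<inter> \<beta> closure_of V'"
        using closure_of_subtopology[of \<beta> K V'] K.openin_subset_carrier[OF V'(1)]
        by (simp add: subtopology_beta Int_absorb1)
      ultimately have "z \<otimes> y \<in> \<tau> closure_of V'" using y(2) by blast
      then have "z \<otimes> y \<in> V0" using closure_of_minimal[OF V'(4,2)] V'(5) by blast
      then show "\<exists>y. y \<in> V0 \<and> y \<in> T" using y by blast
    qed
  qed
  obtain A where A: "openin \<beta> A" "x \<in> A" "\<And>y. y \<in> A \<Longrightarrow> inv x \<otimes> y \<in> \<rho> closure_of V"
    using beta_nbhd x V(1,2) by metis
  \<comment> \<open>The translate by \<open>x\<close> of the \<beta>-closure of \<open>V\<close>,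
    written as a preimage under a \<beta>-continuous map to obtain closedness.\<close>
  define D where "D = {y \<in> carrier H. inv x \<otimes> y \<in> \<beta> closure_of V}"
  have "closedin \<beta> D"
    using closedin_continuous_map_preimage[OF B.continuous_left_mult closedin_closure_of, of "inv x"] x
    by (simp add: D_def topspace_beta)
  moreover have "A \<subseteq> D"
    using A closure_subset_beta_closure B.openin_subset_carrier[OF A(1)] by (auto simp: D_def)
  moreover have "D \<subseteq> U"
  proof
    fix y assume y: "y \<in> D"
    then have "x \<otimes> (inv x \<otimes> y) \<in> U" using sub V0(3) by (auto simp: D_def)
    then show "y \<in> U" using x y by (simp add: D_def m_assoc[symmetric])
  qed
  ultimately show "\<exists>A D. openin \<beta> A \<and> closedin \<beta> D \<and> x \<in> A \<and> A \<subseteq> D \<and> D \<subseteq> U"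
    using A by blast
qed

text \<open>Here \<tau> is the trace of \<rho>, so \<open>B \<inter> K\<close> is a
  \<tau>-neighbourhood of the identity for every \<rho>-neighbourhood \<open>B\<close>. A point
  \<open>v\<close> of its closure satisfies v = (vp) inv p with vp and \<open>p\<close> in
  \<open>B\<close>, so the closure stays within A A.\<close>

lemma beta_eq_if_topological_group:
  assumes "topological_group (H\<lparr>carrier := K\<rparr>) \<tau>"
  shows "\<beta> = \<rho>"
proof -
  have tr: "subtopology \<rho> K = \<tau>"
    using K.sharp_eq_if_topological_group[OF assms] trace by simp
  have "openin \<beta> W" if W: "openin \<rho> W" for W
    unfolding openin_beta
  proof (intro conjI ballI)
    show "W \<subseteq> carrier H" using W openin_subset_carrier by blast
    fix x assume xW: "x \<in> W"
    then have x: "x \<in> carrier H" using W openin_subset_carrier by blast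
    have "openin \<rho> {y \<in> carrier H. x \<otimes> y \<in> W}" "\<one> \<in> {y \<in> carrier H. x \<otimes> y \<in> W}"
      using openin_left_vimage[OF W x] xW x by auto
    then obtain A where A: "openin \<rho> A" "\<one> \<in> A"
      "\<And>a b. a \<in> A \<Longrightarrow> b \<in> A \<Longrightarrow> a \<otimes> b \<in> {y \<in> carrier H. x \<otimes> y \<in> W}"
      by (rule open_root) (rule that)
    define B where "B = A \<inter> {y \<in> carrier H. inv y \<in> A}"
    have B: "openin \<rho> B" "\<one> \<in> B" using A openin_inv_vimage by (auto simp: B_def)
    have "x \<otimes> v \<in> W" if v: "v \<in> \<rho> closure_of (B \<inter> K)" for v
    proof -
      have vc: "v \<in> carrier H" using v closure_subset by blast
      obtain p where p: "p \<in> B" "v \<otimes> p \<in> B \<inter> K" using closure_of_left_nbhd[OF v B] by blast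
      then have "x \<otimes> (v \<otimes> p \<otimes> inv p) \<in> W" using A(3) by (auto simp: B_def)
      then show ?thesis using p vc by (simp add: B_def m_assoc)
    qed
    moreover have "openin \<tau> (B \<inter> K)" using B tr by (metis openin_subtopology_Int)
    moreover have "\<one> \<in> B \<inter> K" using B subgroup.one_closed[OF subgroup_K] by simp
    ultimately show "\<exists>V. openin \<tau> V \<and> \<one> \<in> V \<and> (\<forall>v\<in>\<rho> closure_of V. x \<otimes> v \<in> W)" by blast
  qed
  then show ?thesis using beta_coarser by (auto simp: topology_eq)
qed

lemma t0_space_beta:
  assumes "Hausdorff_space \<rho>"
  shows "t0_space \<beta>"
  using B.t0_space_if_sharp Hausdorff_imp_t0_space[OF assms] by (simp add: sharp_beta)

end

section \<open>Transfer to the given pair of groups\<close>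

lemma group_topology_restrict:
  assumes "group G" "group H" "subgroup (carrier G) H" "topspace \<tau> = carrier G"
    and mult: "\<forall>x\<in>carrier G. \<forall>y\<in>carrier G. x \<otimes>\<^bsub>G\<^esub> y = x \<otimes>\<^bsub>H\<^esub> y"
  shows "paratopological_group G \<tau> \<Longrightarrow> paratopological_group (H\<lparr>carrier := carrier G\<rparr>) \<tau>"
    and "topological_group G \<tau> \<Longrightarrow> topological_group (H\<lparr>carrier := carrier G\<rparr>) \<tau>"
    and "sharp (H\<lparr>carrier := carrier G\<rparr>) \<tau> = sharp G \<tau>"
proof -
  interpret G: group G by fact
  interpret H: group H by fact
  let ?K = "H\<lparr>carrier := carrier G\<rparr>"
  interpret K: group ?K using H.subgroup_imp_group assms(3) by blast
  \<comment> \<open>Only the multiplications are assumed to agree. The identity map is therefore a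
    homomorphism, and this forces the identities and inverses to agree as well.\<close>
  have id: "(\<lambda>x. x) \<in> hom G ?K" using mult by (auto simp: hom_def)
  have hom: "group_hom G ?K (\<lambda>x. x)" by unfold_locales (rule id)
  have one: "\<one>\<^bsub>?K\<^esub> = \<one>\<^bsub>G\<^esub>" using group_hom.hom_one[OF hom] ..
  have carrier: "carrier ?K = carrier G" by simp
  have inv: "inv\<^bsub>?K\<^esub> x = inv\<^bsub>G\<^esub> x" if "x \<in> carrier G" for x
    using group_hom.hom_inv[OF hom that] ..
  show par: "paratopological_group ?K \<tau>" if "paratopological_group G \<tau>"
    unfolding paratopological_group_def
  proof (intro conjI)
    show "group ?K" by (rule K.is_group)
    show "topspace \<tau> = carrier ?K" using assms(4) by simp
    have "continuous_map (prod_topology \<tau> \<tau>) \<tau> (\<lambda>(x, y). x \<otimes>\<^bsub>G\<^esub> y)"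
      using that by (simp add: paratopological_group_def)
    then show "continuous_map (prod_topology \<tau> \<tau>) \<tau> (\<lambda>(x, y). x \<otimes>\<^bsub>?K\<^esub> y)"
      by (rule continuous_map_eq) (auto simp: assms(4) mult)
  qed
  show "topological_group ?K \<tau>" if top: "topological_group G \<tau>"
    unfolding topological_group_def
  proof
    show "paratopological_group ?K \<tau>" using top par by (simp add: topological_group_def)
    have "continuous_map \<tau> \<tau> (\<lambda>x. inv\<^bsub>G\<^esub> x)" using top by (simp add: topological_group_def)
    then show "continuous_map \<tau> \<tau> (\<lambda>x. inv\<^bsub>?K\<^esub> x)"
      by (rule continuous_map_eq) (auto simp: assms(4) inv)
  qed
  have "openin (sharp ?K \<tau>) W \<longleftrightarrow> openin (sharp G \<tau>) W" for W
  proof -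
    \<comment> \<open>The cosets agree only for points and sets inside the common carrier, which the
      conditions on \<open>x\<close> and \<open>U\<close> in \<open>openin_sharp\<close>
      ensure.\<close>
    have eq: "x <#\<^bsub>?K\<^esub> (U \<inter> set_inv\<^bsub>?K\<^esub> U) = x <#\<^bsub>G\<^esub> (U \<inter> set_inv\<^bsub>G\<^esub> U)"
      if "W \<subseteq> carrier G" "x \<in> W" "openin \<tau> U" for x U
    proof -
      have x: "x \<in> carrier G" using that by blast
      have U: "U \<subseteq> carrier G" using that(3) assms(4) openin_subset by blast
      have "set_inv\<^bsub>?K\<^esub> U = set_inv\<^bsub>G\<^esub> U"
        unfolding SET_INV_def using U inv by (intro SUP_cong) auto
      then show ?thesis
        unfolding l_coset_def using U x mult by (intro SUP_cong) auto
    qed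
    show ?thesis
      unfolding openin_sharp by (intro conj_cong ball_cong ex_cong1)
        (simp_all only: one carrier eq)
  qed
  then show "sharp ?K \<tau> = sharp G \<tau>" by (simp add: topology_eq)
qed

theorem theorem2p6:
  fixes G :: "('a, 'b) monoid_scheme" and H :: "('a, 'c) monoid_scheme"
    and \<tau> \<rho> \<beta> :: "'a topology"
  assumes "paratopological_group G \<tau>" and "t0_space \<tau>"
    and "is_raikov_completion G (sharp G \<tau>) H \<rho>"
    and "\<beta> = raikov_topology H \<rho> \<tau>"
  shows
    "(coarser_topology (semiregularization \<tau>) \<tau> \<and> \<tau> = subtopology \<beta> (carrier G)) \<and>
     (coarser_topology \<beta> \<rho> \<and> \<rho> = sharp H \<beta>) \<and>
     t0_space \<beta> \<and>
     (regular_space \<tau> \<longrightarrow>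
        \<tau> = subtopology \<beta> (carrier G) \<and>
        subtopology \<beta> (carrier G) = subtopology (semiregularization \<beta>) (carrier G) \<and>
        \<rho> = sharp H \<beta> \<and> sharp H \<beta> = sharp H (semiregularization \<beta>) \<and>
        coarser_topology (semiregularization \<beta>) \<beta> \<and>
        Hausdorff_space (semiregularization \<beta>) \<and> Hausdorff_space \<beta>) \<and>
     (topological_group G \<tau> \<longrightarrow> \<beta> = \<rho>)"
proof -
  have H: "topological_group H \<rho>" "Hausdorff_space \<rho>" "subgroup (carrier G) H"
    "\<forall>x\<in>carrier G. \<forall>y\<in>carrier G. x \<otimes>\<^bsub>G\<^esub> y = x \<otimes>\<^bsub>H\<^esub> y"
    "\<rho> closure_of carrier G = carrier H" "subtopology \<rho> (carrier G) = sharp G \<tau>"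
    using assms(3) by (auto simp: is_raikov_completion_def)
  have groups: "group G" "group H" "topspace \<tau> = carrier G"
    using assms(1) H(1) by (auto simp: topological_group_def paratopological_group_def)
  note restrict = group_topology_restrict[OF groups(1,2) H(3) groups(3) H(4)]
  interpret raikov_pair H \<rho> "carrier G" \<tau>
    using H restrict(1)[OF assms(1)] restrict(3)
    by (intro raikov_pair.intro paratop_group.intro raikov_pair_axioms.intro)
      (simp_all add: topological_group_def)
  \<comment> \<open>In the regular case all claims about the semiregularization reduce to claims
    about \<beta>.\<close>
  have semireg: "semiregularization \<beta> = \<beta>" if "regular_space \<tau>"
    using semiregularization_eq_if_regular_space regular_space_beta[OF that] assms(4) by simp
  have haus: "Hausdorff_space \<beta>" if "regular_space \<tau>"
    using regular_t0_imp_Hausdorff_space regular_space_beta[OF that] t0_space_beta[OF H(2)] assms(4)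
    by simp
  have "coarser_topology \<beta> \<rho>"
    using beta_coarser assms(4) by (auto simp: coarser_topology_def)
  moreover have "\<beta> = \<rho>" if "topological_group G \<tau>"
    using beta_eq_if_topological_group restrict(2)[OF that] assms(4) by simp
  ultimately show ?thesis
    using coarser_topology_semiregularization subtopology_beta sharp_beta t0_space_beta[OF H(2)]
      semireg haus assms(4) by (auto simp: coarser_topology_def)
qed

end
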